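(* Let $A$ be a $\mathbb{Q}(q)$-algebra and let $f:\mathbb{H}\to A$ be a function that satisfies the restricted modular law. Then $f$ is determined by its values $f(\mathbf{p}_{n_1}+\cdots+\mathbf{p}_{n_d})$ at the disjoint unions of paths ($d\ge1$, $n_1,\dots,n_d\ge1$). That is, if $f,f':\mathbb{H}\to A$ both satisfy the restricted modular law and $f(\mathbf{p}_{n_1}+\cdots+\mathbf{p}_{n_d})=f'(\mathbf{p}_{n_1}+\cdots+\mathbf{p}_{n_d})$ for all $d\ge 1$ and all positive integers $n_1,\dots,n_d$, then $f=f'$.
   Context: $[n]=\{1,\dots,n\}$. A Hessenberg function of length $n$ is a weakly increasing map $\mathbf{m}:[n]\to[n]$ with $i\le\mathbf{m}(i)$ for all $i$, written as the tuple $(\mathbf{m}(1),\dots,\mathbf{m}(n))$; $\mathbb{H}_n$ is the set of these and $\mathbb{H}=\bigcup_{n\ge1}\mathbb{H}_n$. For $\mathbf{m}_1\in\mathbb{H}_{n_1}$, $\mathbf{m}_2\in\mathbb{H}_{n_2}$, $\mathbf{m}_1+\mathbf{m}_2=(\mathbf{m}_1(1),\dots,\mathbf{m}_1(n_1),\mathbf{m}_2(1)+n_1,\dots,\mathbf{m}_2(n_2)+n_1)\in\mathbb{H}_{n_1+n_2}$. $\mathbf{p}_1=(1)$ and $\mathbf{p}_n=(2,3,\dots,n,n)$ for $n\ge2$. A triple $(\mathbf{m},\mathbf{m}',\mathbf{m}'')\in\mathbb{H}_n^3$ is a modular triple of type I if there is $i\in[n-1]$ such that: (1) $\mathbf{m}(i)+1=\mathbf{m}'(i)=\mathbf{m}''(i)-1$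 and $\mathbf{m}'(i-1)<\mathbf{m}'(i)<\mathbf{m}'(i+1)$, where $\mathbf{m}'(0)=0$; (2) $\mathbf{m}(j)=\mathbf{m}'(j)=\mathbf{m}''(j)$ for all $j\in[n]\setminus\{i\}$; (3) $\mathbf{m}'(\mathbf{m}'(i))=\mathbf{m}'(\mathbf{m}'(i)+1)$. It is a restricted modular triple of type II if there is $i\in[n-1]$ with $i\ne1$ such that: (1) $\mathbf{m}'(i)+1=\mathbf{m}'(i+1)$, $\mathbf{m}(i)=\mathbf{m}'(i)=\mathbf{m}''(i)-1$, and $\mathbf{m}(i+1)+1=\mathbf{m}'(i+1)=\mathbf{m}''(i+1)$; (2) $\mathbf{m}(j)=\mathbf{m}'(j)=\mathbf{m}''(j)$ for all $j\in[n]\setminus\{i,i+1\}$; (3) $(\mathbf{m}')^{-1}(\{i\})=\emptyset$. A function $f:\mathbb{H}\to A$ satisfies the restricted modular law if $(1+q)f(\mathbf{m}')=qf(\mathbf{m})+f(\mathbf{m}'')$ whenever $(\mathbf{m},\mathbf{m}',\mathbf{m}'')$ is a modular triple of type I or a restricted modular triple of type II. *)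

theory Defs
  imports "HOL-Computational_Algebra.Computational_Algebra"
begin

text \<open>The field of rational functions in one variable over the rationals, and its variable.\<close>

type_synonym Qq = "rat poly fract"

definition q :: Qq where
  "q = Fract [:0, 1:] 1"

text \<open>
  Associative algebras over the field of rational functions. A unit is not demanded and
  multiplication need not commute, so that every convention (including the zero algebra)
  is covered.
\<close>

locale Qq_algebra = vector_space scale
  for scale :: "Qq \<Rightarrow> 'a::ring \<Rightarrow> 'a" +
  assumes scale_mult_left: "scale c x * y = scale c (x * y)"
    and scale_mult_right: "x * scale c y = scale c (x * y)"

text \<open>
  A Hessenberg function is represented by the tuple (list) of its values. The function
  \<open>val m\<close> reads the tuple with indices starting from 1, together with the
  convention \<open>val m 0 = 0\<close>.
\<close>

definition val :: "nat list \<Rightarrow> nat \<Rightarrow> nat" where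
  "val m i = (if i = 0 then 0 else m ! (i - 1))"

definition hessenberg_of_length :: "nat \<Rightarrow> nat list set" where
  "hessenberg_of_length n =
     {m. length m = n \<and> (\<forall>i\<in>{1..n}. val m i \<in> {1..n}) \<and>
         mono_on {1..n} (val m) \<and> (\<forall>i\<in>{1..n}. i \<le> val m i)}"

definition hessenberg :: "nat list set" where
  "hessenberg = (\<Union>n\<in>{1..}. hessenberg_of_length n)"

definition hess_add :: "nat list \<Rightarrow> nat list \<Rightarrow> nat list" where
  "hess_add m1 m2 = m1 @ map (\<lambda>k. k + length m1) m2"

definition path :: "nat \<Rightarrow> nat list" where
  "path n = (if n = 1 then [1] else [2..<n + 1] @ [n])"

text \<open>The empty tuple is neutral for \<^const>\<open>hess_add\<close>, so the fold may start from it.\<close>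

definition path_union :: "nat list \<Rightarrow> nat list" where
  "path_union ns = foldr hess_add (map path ns) []"

definition modular_triple_I :: "nat \<Rightarrow> nat list \<Rightarrow> nat list \<Rightarrow> nat list \<Rightarrow> bool" where
  "modular_triple_I n m m' m'' \<longleftrightarrow>
     m \<in> hessenberg_of_length n \<and> m' \<in> hessenberg_of_length n \<and> m'' \<in> hessenberg_of_length n \<and>
     (\<exists>i\<in>{1..<n}.
        val m i + 1 = val m' i \<and> val m' i + 1 = val m'' i \<and>
        val m' (i - 1) < val m' i \<and> val m' i < val m' (i + 1) \<and>
        (\<forall>j\<in>{1..n} - {i}. val m j = val m' j \<and> val m' j = val m'' j) \<and>
        val m' (val m' i) = val m' (val m' i + 1))"

definition restricted_modular_triple_II ::
    "nat \<Rightarrow> nat list \<Rightarrow> nat list \<Rightarrow> nat list \<Rightarrow> bool" where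
  "restricted_modular_triple_II n m m' m'' \<longleftrightarrow>
     m \<in> hessenberg_of_length n \<and> m' \<in> hessenberg_of_length n \<and> m'' \<in> hessenberg_of_length n \<and>
     (\<exists>i\<in>{1..<n}. i \<noteq> 1 \<and>
        val m' i + 1 = val m' (i + 1) \<and>
        val m i = val m' i \<and> val m' i + 1 = val m'' i \<and>
        val m (i + 1) + 1 = val m' (i + 1) \<and> val m' (i + 1) = val m'' (i + 1) \<and>
        (\<forall>j\<in>{1..n} - {i, i + 1}. val m j = val m' j \<and> val m' j = val m'' j) \<and>
        {j\<in>{1..n}. val m' j = i} = {})"

definition restricted_modular_law ::
    "(Qq \<Rightarrow> 'a::ring \<Rightarrow> 'a) \<Rightarrow> (nat list \<Rightarrow> 'a) \<Rightarrow> bool" where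
  "restricted_modular_law scale f \<longleftrightarrow>
     (\<forall>n\<ge>1. \<forall>m m' m''.
        modular_triple_I n m m' m'' \<or> restricted_modular_triple_II n m m' m'' \<longrightarrow>
        scale (1 + q) (f m') = scale q (f m) + f m'')"

end

theory Submission
  imports Defs
begin

text \<open>
  Order the Hessenberg functions of length \<open>n\<close> lexicographically as tuples. Every \<open>m\<close> that is not
  a disjoint union of paths has its value expressed, through the restricted modular law, by
  values at lexicographically smaller tuples; well-founded induction then gives the theorem.

  The reduction happens at a row \<open>i\<close> where \<open>m\<close> has a jump, i.e.
  \<open>m (i - 1) + 2 \<le> m i\<close> and \<open>i + 2 \<le> m i\<close>. Such a row exists unless \<open>m j \<le> j + 1\<close> for all \<open>j\<close>
  (take the least \<open>j\<close> that violates this inequality), and the latter condition makes \<open>m\<close> a union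
  of paths (\<open>path_union_if_val_le_Suc\<close>). Put \<open>k = m i\<close> and compare rows \<open>k - 1\<close> and \<open>k\<close>.

  \<^item> If \<open>m (k - 1) = m k\<close>, then \<open>m\<close> is the largest member of a triple of type I whose other members
    have the value \<open>k - 1\<close> or \<open>k - 2\<close> in row \<open>i\<close>; the jump leaves room for both.
  \<^item> If \<open>m (k - 1) + 1 = m k\<close>, then \<open>m\<close> is the middle member of a triple of type II at index
    \<open>k - 1\<close>: \<open>m\<close> omits the value \<open>k - 1\<close>, which it skips at the jump. The index is larger than
    \<open>1\<close>, so the triple is restricted. In the outer two members rows \<open>k - 1\<close> and \<open>k\<close> are equal, and
    these members differ from \<open>m\<close> only after row \<open>i\<close>. One of them exceeds \<open>m\<close>, but the first case
    expresses both by tuples with a smaller row \<open>i\<close>, and these lie lexicographically below \<open>m\<close>.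
  \<^item> Otherwise \<open>k\<close> is itself a jump row, and \<open>k > i\<close>, so this recursion ends.

  A triple of type I is solved for its largest member, whose coefficient is \<open>1\<close>, and a triple of
  type II for its middle member, whose coefficient \<open>1 + q\<close> is invertible.
\<close>

section \<open>Hessenberg functions as tuples\<close>

lemma hessenberg_of_length_iff:
  "m \<in> hessenberg_of_length n \<longleftrightarrow>
     length m = n \<and> (\<forall>i. 1 \<le> i \<longrightarrow> i \<le> n \<longrightarrow> i \<le> val m i \<and> val m i \<le> n) \<and>
     (\<forall>i j. 1 \<le> i \<longrightarrow> i \<le> j \<longrightarrow> j \<le> n \<longrightarrow> val m i \<le> val m j)"
  unfolding hessenberg_of_length_def mono_on_def by fastforce

lemma hessenberg_val_mono:
  assumes "m \<in> hessenberg_of_length n" "i \<le> j" "j \<le> n"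
  shows "val m i \<le> val m j"
proof (cases "i = 0")
  case True
  then show ?thesis by (simp add: val_def)
next
  case False
  then show ?thesis using assms by (simp add: hessenberg_of_length_iff)
qed

lemma val_list_update:
  assumes "1 \<le> i" "i \<le> length m"
  shows "val (m[i - 1 := v]) j = (if j = i then v else val m j)"
  using assms by (auto simp: val_def nth_list_update)

lemma hessenberg_list_update:
  assumes m: "m \<in> hessenberg_of_length n"
    and i: "1 \<le> i" "i \<le> n"
    and v: "i \<le> v" "v \<le> n" "val m (i - 1) \<le> v" "\<And>j. i < j \<Longrightarrow> j \<le> n \<Longrightarrow> v \<le> val m j"
  shows "m[i - 1 := v] \<in> hessenberg_of_length n"
proof -
  have len: "length m = n"
    using m by (simp add: hessenberg_of_length_iff)
  have below: "val m j \<le> v" if "j < i" for j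
  proof -
    have "j \<le> i - 1" "i - 1 \<le> n" using that i by linarith+
    then show ?thesis using hessenberg_val_mono[OF m] v(3) by (meson le_trans)
  qed
  show ?thesis
    using m i v below len
    unfolding hessenberg_of_length_iff val_list_update[OF i(1) i(2)[folded len]]
    by auto
qed

lemma lex_less_at_first_difference:
  fixes xs ys :: "nat list"
  assumes "length xs = length ys" "p < length ys" "take p xs = take p ys" "xs ! p < ys ! p"
  shows "(xs, ys) \<in> lex less_than"
proof -
  have "xs = take p ys @ xs ! p # drop (Suc p) xs"
    using assms by (metis id_take_nth_drop)
  moreover have "ys = take p ys @ ys ! p # drop (Suc p) ys"
    using assms by (metis id_take_nth_drop)
  ultimately show ?thesis
    using assms unfolding lex_conv by blast
qed

section \<open>Disjoint unions of paths\<close>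

lemma hess_add_path_Suc:
  assumes "1 \<le> k"
  shows "hess_add (path (Suc k)) m = 2 # map Suc (hess_add (path k) m)"
proof -
  have "path (Suc k) = 2 # map Suc (path k)"
    using assms by (auto simp: path_def map_Suc_upt upt_conv_Cons simp del: upt_Suc)
  moreover have "length (path k) = k"
    using assms unfolding path_def by (cases "k = 1") simp_all
  ultimately show ?thesis
    by (simp add: hess_add_def)
qed

text \<open>
  Peel off the first vertex. It either is a component of its own (first entry \<open>1\<close>) or it
  lengthens the first path of the remaining union (first entry \<open>2\<close>).
\<close>

lemma path_union_if_val_le_Suc:
  assumes "m \<in> hessenberg_of_length n" "1 \<le> n" "\<And>i. 1 \<le> i \<Longrightarrow> i \<le> n \<Longrightarrow> val m i \<le> i + 1"
  shows "\<exists>ns. ns \<noteq> [] \<and> (\<forall>k\<in>set ns. 1 \<le> k) \<and> m = path_union ns"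
  using assms
proof (induction n arbitrary: m)
  case 0
  then show ?case by simp
next
  case (Suc n)
  note H = Suc.prems(1)[unfolded hessenberg_of_length_iff]
  then obtain c t where m: "m = c # t"
    by (cases m) auto
  have c: "c = 1 \<or> c = 2"
    using H Suc.prems(3)[of 1] m by (force simp: val_def)
  show ?case
  proof (cases "n = 0")
    case True
    then have "m = path_union [1]"
      using H m c by (auto simp: val_def path_union_def path_def hess_add_def)
    then show ?thesis by (intro exI[of _ "[1]"]) simp
  next
    case False
    define r where "r = map (\<lambda>x. x - 1) t"
    have len: "length t = n" using H m by simp
    have val_m: "val m (Suc i) = t ! (i - 1)" if "1 \<le> i" for i
      using that m by (simp add: val_def nth_Cons')
    have val_r: "val r i = val m (Suc i) - 1" if "1 \<le> i" "i \<le> n" for i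
      using that len val_m by (simp add: val_def r_def)
    have bounds: "Suc i \<le> val m (Suc i)" "val m (Suc i) \<le> Suc n" if "i \<le> n" for i
      using H that by auto
    have t: "t = map Suc r"
    proof (rule nth_equalityI)
      fix i assume i: "i < length t"
      then show "t ! i = map Suc r ! i"
        using bounds(1)[of "Suc i"] val_m[of "Suc i"] len by (simp add: r_def)
    qed (simp add: r_def)
    have mono: "val m (Suc i) \<le> val m (Suc j)" if "i \<le> j" "j \<le> n" for i j
      using H that by auto
    have "r \<in> hessenberg_of_length n"
      unfolding hessenberg_of_length_iff
    proof (intro conjI allI impI)
      show "length r = n" using len by (simp add: r_def)
    next
      fix i assume i: "1 \<le> i" "i \<le> n"
      show "i \<le> val r i" "val r i \<le> n"
        using bounds[of i] val_r i by auto
    next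
      fix i j assume "1 \<le> i" "i \<le> j" "j \<le> n"
      then show "val r i \<le> val r j"
        using val_r mono[of i j] by simp
    qed
    moreover have "val r i \<le> i + 1" if "1 \<le> i" "i \<le> n" for i
      using Suc.prems(3)[of "Suc i"] val_r that by simp
    ultimately obtain ns where ns: "ns \<noteq> []" "\<forall>k\<in>set ns. 1 \<le> k" "r = path_union ns"
      using Suc.IH False by (metis One_nat_def Suc_leI neq0_conv)
    from c show ?thesis
    proof
      assume "c = 1"
      then have "m = path_union (1 # ns)"
        using m t ns by (simp add: path_union_def hess_add_def path_def)
      then show ?thesis using ns by (intro exI[of _ "1 # ns"]) simp
    next
      assume c2: "c = 2"
      obtain k ks where k: "ns = k # ks" using ns by (cases ns) auto
      have "m = path_union (Suc k # ks)"
        using m t ns k c2 hess_add_path_Suc[of k] by (simp add: path_union_def)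
      then show ?thesis using ns k by (intro exI[of _ "Suc k # ks"]) simp
    qed
  qed
qed

section \<open>Agreement of two solutions of the restricted modular law\<close>

lemma one_plus_q_nonzero: "1 + q \<noteq> 0"
  by (simp add: q_def One_fract_def Zero_fract_def eq_fract one_pCons)

locale restricted_modular_pair = Qq_algebra scale
  for scale :: "Qq \<Rightarrow> 'a::ring \<Rightarrow> 'a" +
  fixes f f' :: "nat list \<Rightarrow> 'a"
  assumes law: "restricted_modular_law scale f"
    and law': "restricted_modular_law scale f'"
begin

lemma agree_type_I:
  assumes T: "modular_triple_I n m m' m''"
    and agree: "f m = f' m" "f m' = f' m'"
  shows "f m'' = f' m''"
proof -
  have "1 \<le> n"
    using T unfolding modular_triple_I_def by auto
  then have "scale (1 + q) (f m') = scale q (f m) + f m''"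
      "scale (1 + q) (f' m') = scale q (f' m) + f' m''"
    using law law' T unfolding restricted_modular_law_def by blast+
  then show ?thesis using agree by simp
qed

lemma agree_restricted_type_II:
  assumes T: "restricted_modular_triple_II n m m' m''"
    and agree: "f m = f' m" "f m'' = f' m''"
  shows "f m' = f' m'"
proof -
  have "1 \<le> n"
    using T unfolding restricted_modular_triple_II_def by auto
  then have "scale (1 + q) (f m') = scale q (f m) + f m''"
      "scale (1 + q) (f' m') = scale q (f' m) + f' m''"
    using law law' T unfolding restricted_modular_law_def by blast+
  then have "scale (1 + q) (f m') = scale (1 + q) (f' m')" using agree by simp
  then show ?thesis using one_plus_q_nonzero scale_cancel_left by blast
qed

text \<open>
  When rows \<open>k - 1\<close> and \<open>k\<close> agree for \<open>k = val m i\<close>, the tuples with \<open>k - 2\<close>, \<open>k - 1\<close> and \<open>k\<close> in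
  row \<open>i\<close> form a triple of type I with \<open>m\<close> on top.
\<close>

lemma agree_by_lowering_row:
  assumes m: "m \<in> hessenberg_of_length n" and i: "1 \<le> i" "i \<le> n"
    and jump: "i + 2 \<le> val m i" "val m (i - 1) + 2 \<le> val m i"
    and flat: "val m (val m i - 1) = val m (val m i)"
    and lower: "\<And>v. v < val m i \<Longrightarrow> m[i - 1 := v] \<in> hessenberg_of_length n
                  \<Longrightarrow> f (m[i - 1 := v]) = f' (m[i - 1 := v])"
  shows "f m = f' m"
proof -
  define k where "k = val m i"
  have len: "length m = n" using m by (simp add: hessenberg_of_length_iff)
  have k: "k \<le> n" "i + 2 \<le> k" "val m (i - 1) + 2 \<le> k" "val m (k - 1) = val m k"
    using m i jump flat by (simp_all add: hessenberg_of_length_iff k_def)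
  have above: "k \<le> val m j" if "i < j" "j \<le> n" for j
    using hessenberg_val_mono[OF m, of i j] that by (simp add: k_def)
  have lowered: "m[i - 1 := v] \<in> hessenberg_of_length n" if "k - 2 \<le> v" "v < k" for v
    using that k above i by (intro hessenberg_list_update[OF m]) force+
  have vals: "val (m[i - 1 := v]) j = (if j = i then v else val m j)" for v j
    using val_list_update i len by blast
  have "modular_triple_I n (m[i - 1 := k - 2]) (m[i - 1 := k - 1]) m"
    unfolding modular_triple_I_def
  proof (intro conjI bexI[of _ i] ballI)
    show "m[i - 1 := k - 2] \<in> hessenberg_of_length n" "m[i - 1 := k - 1] \<in> hessenberg_of_length n"
      using lowered k by auto
    show "val (m[i - 1 := k - 1]) i < val (m[i - 1 := k - 1]) (i + 1)"
      unfolding vals using above[of "i + 1"] k by simp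
  qed (use m k i in \<open>unfold vals, auto simp: k_def\<close>)
  then show ?thesis
    by (rule agree_type_I) (use lower lowered k in \<open>auto simp: k_def\<close>)
qed

text \<open>
  The recursion passes from row \<open>i\<close> to row \<open>val m i\<close>, so the induction is on the number of rows after
  \<open>i\<close> while \<open>m\<close> stays the same.
\<close>

lemma agree_at_jump:
  assumes m: "m \<in> hessenberg_of_length n"
    and smaller: "\<And>m0. m0 \<in> hessenberg_of_length n \<Longrightarrow> (m0, m) \<in> lex less_than \<Longrightarrow> f m0 = f' m0"
    and "1 \<le> i" "i \<le> n" "i + 2 \<le> val m i" "val m (i - 1) + 2 \<le> val m i"
  shows "f m = f' m"
  using assms(3-6)
proof (induction "n - i" arbitrary: i rule: less_induct)
  case less
  note i = less.prems(1,2)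
  define k where "k = val m i"
  have len: "length m = n" using m by (simp add: hessenberg_of_length_iff)
  have k: "k \<le> n" "i + 2 \<le> k" "val m (i - 1) + 2 \<le> k"
    using m less.prems by (simp_all add: hessenberg_of_length_iff k_def)
  have above: "k \<le> val m j" if "i \<le> j" "j \<le> n" for j
    using hessenberg_val_mono[OF m, of i j] that by (simp add: k_def)
  have below: "val m j + 2 \<le> k" if "j < i" for j
  proof -
    have "j \<le> i - 1" "i - 1 \<le> n" using that i by linarith+
    then have "val m j \<le> val m (i - 1)" by (rule hessenberg_val_mono[OF m])
    then show ?thesis using k by linarith
  qed
  have step: "val m (k - 1) \<le> val m k"
    using hessenberg_val_mono[OF m] k by simp
  have val_k: "k \<le> val m (k - 1)" "val m k \<le> n"
    using above k m by (auto simp: hessenberg_of_length_iff)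
  \<comment> \<open>Stated for tuples \<open>u\<close> that may differ from \<open>m\<close> after row \<open>i\<close>, because it is also applied to the
    outer members of a triple of type II around \<open>m\<close>. Lowering row \<open>i\<close> of \<open>u\<close> gives a tuple below \<open>m\<close>
    whatever happens after row \<open>i\<close>.\<close>
  have flat_case: "f u = f' u"
    if u: "u \<in> hessenberg_of_length n" and prefix: "take i u = take i m"
      and flat: "val u (k - 1) = val u k" for u
  proof (rule agree_by_lowering_row[OF u i])
    have len_u: "length u = n" using u by (simp add: hessenberg_of_length_iff)
    have same: "u ! j = m ! j" if "j < i" for j
      using prefix that by (metis nth_take)
    then have val_u: "val u j = val m j" if "j \<le> i" for j
      using that by (simp add: val_def)
    show "i + 2 \<le> val u i" "val u (i - 1) + 2 \<le> val u i"
        "val u (val u i - 1) = val u (val u i)"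
      using less.prems flat by (simp_all add: val_u k_def)
    fix v assume v: "v < val u i" "u[i - 1 := v] \<in> hessenberg_of_length n"
    have "(u[i - 1 := v], m) \<in> lex less_than"
    proof (rule lex_less_at_first_difference[of _ _ "i - 1"])
      show "take (i - 1) (u[i - 1 := v]) = take (i - 1) m"
        using prefix by (metis diff_le_self min.absorb1 order_refl take_take take_update_cancel)
      show "u[i - 1 := v] ! (i - 1) < m ! (i - 1)"
        using v val_u[of i] i len_u by (simp add: val_def)
    qed (use len_u len i in auto)
    then show "f (u[i - 1 := v]) = f' (u[i - 1 := v])"
      using smaller v by blast
  qed
  consider "val m (k - 1) = val m k" | "val m (k - 1) + 1 = val m k"
    | "val m (k - 1) + 2 \<le> val m k"
    using step by linarith
  then show ?case
  proof cases
    case 1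
    then show ?thesis using flat_case[OF m] by simp
  next
    case 2
    define a where "a = val m (k - 1)"
    define lo where "lo = m[k - 1 := a]"
    define hi where "hi = m[(k - 1) - 1 := a + 1]"
    have a: "k \<le> a" "val m k = a + 1" "val m (k - 1) = a" "a + 1 \<le> n"
      using 2 val_k by (auto simp: a_def)
    have val_lo: "val lo j = (if j = k then a else val m j)" for j
      unfolding lo_def using val_list_update k len by simp
    have val_hi: "val hi j = (if j = k - 1 then a + 1 else val m j)" for j
      unfolding hi_def using val_list_update[of "k - 1"] k len by simp
    have lo: "lo \<in> hessenberg_of_length n"
      unfolding lo_def
    proof (rule hessenberg_list_update[OF m])
      show "a \<le> val m j" if "k < j" "j \<le> n" for j
        using hessenberg_val_mono[OF m, of k j] that a by simp
    qed (use k a in auto)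
    have hi: "hi \<in> hessenberg_of_length n"
      unfolding hi_def
    proof (rule hessenberg_list_update[OF m])
      show "a + 1 \<le> val m j" if "k - 1 < j" "j \<le> n" for j
        using hessenberg_val_mono[OF m, of k j] that a by simp
      show "val m (k - 1 - 1) \<le> a + 1"
      proof -
        have "k - 1 - 1 \<le> k - 1" "k - 1 \<le> n" using k by linarith+
        then have "val m (k - 1 - 1) \<le> val m (k - 1)" by (rule hessenberg_val_mono[OF m])
        then show ?thesis using a by linarith
      qed
    qed (use k a in auto)
    \<comment> \<open>Rows before \<open>i\<close> stay at or below \<open>k - 2\<close> by the jump; the others start from \<open>k\<close>.\<close>
    have omitted: "val m j \<noteq> k - 1" if "j \<le> n" for j
      using above[of j] below[of j] that k by (cases "j < i") auto
    have "restricted_modular_triple_II n lo m hi"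
      unfolding restricted_modular_triple_II_def
    proof (intro conjI bexI[of _ "k - 1"])
      show "{j \<in> {1..n}. val m j = k - 1} = {}" using omitted by auto
    qed (use lo hi m i k a in \<open>auto simp: val_lo val_hi\<close>)
    moreover have "f lo = f' lo"
    proof (rule flat_case[OF lo])
      show "take i lo = take i m" unfolding lo_def using k by simp
      show "val lo (k - 1) = val lo k" unfolding val_lo using k a by simp
    qed
    moreover have "f hi = f' hi"
    proof (rule flat_case[OF hi])
      show "take i hi = take i m" unfolding hi_def using k by simp
      show "val hi (k - 1) = val hi k" unfolding val_hi using k a by simp
    qed
    ultimately show ?thesis by (rule agree_restricted_type_II)
  next
    case 3
    show ?thesis
      by (rule less.hyps[of k]) (use 3 k val_k in auto)
  qed
qed

lemma agree_on_hessenberg: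
  assumes paths: "\<And>ns. ns \<noteq> [] \<Longrightarrow> \<forall>k\<in>set ns. 1 \<le> k \<Longrightarrow> f (path_union ns) = f' (path_union ns)"
    and "1 \<le> n" "m \<in> hessenberg_of_length n"
  shows "f m = f' m"
  using assms(3)
proof (induction m rule: wf_induct_rule[OF wf_lex[OF wf_less_than]])
  case (1 m)
  show ?case
  proof (cases "\<forall>i. 1 \<le> i \<longrightarrow> i \<le> n \<longrightarrow> val m i \<le> i + 1")
    case True
    then show ?thesis
      using path_union_if_val_le_Suc[OF 1(2) \<open>1 \<le> n\<close>] paths by blast
  next
    case False
    define P where "P i \<longleftrightarrow> 1 \<le> i \<and> i \<le> n \<and> \<not> val m i \<le> i + 1" for i
    define i where "i = (LEAST i. P i)"
    have "\<exists>i. P i" using False by (auto simp: P_def)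
    then have i: "P i" unfolding i_def by (rule LeastI_ex)
    have "val m (i - 1) \<le> i"
    proof (cases "i = 1")
      case False
      have "\<not> P (i - 1)"
      proof
        assume "P (i - 1)"
        then have "i \<le> i - 1" unfolding i_def by (rule Least_le)
        then show False using i unfolding P_def by linarith
      qed
      moreover have "1 \<le> i - 1" "i - 1 \<le> n" "i - 1 + 1 = i"
        using i False unfolding P_def by linarith+
      ultimately show ?thesis unfolding P_def by simp
    qed (simp add: val_def)
    then show ?thesis
      using i 1 by (intro agree_at_jump[of m n i]) (auto simp: P_def)
  qed
qed

end

theorem theorem3p7:
  fixes scale :: "Qq \<Rightarrow> 'a::ring \<Rightarrow> 'a"
    and f f' :: "nat list \<Rightarrow> 'a"
  assumes "Qq_algebra scale"
    and "restricted_modular_law scale f"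
    and "restricted_modular_law scale f'"
    and "\<And>ns. ns \<noteq> [] \<Longrightarrow> \<forall>k\<in>set ns. 1 \<le> k \<Longrightarrow> f (path_union ns) = f' (path_union ns)"
  shows "\<forall>m\<in>hessenberg. f m = f' m"
proof -
  interpret Qq_algebra scale by fact
  interpret restricted_modular_pair scale f f'
    by unfold_locales (fact assms(2), fact assms(3))
  show ?thesis
    using agree_on_hessenberg assms(4) unfolding hessenberg_def by fastforce
qed

end
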